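(* Let $G$ be a finite group of order $|G|$. Let $B$ be a ring with local units satisfying $|G|B = B$. Let $A$ denote the group ring $B[G]$. Then $A/B$ is separable.
   Context: Rings are associative but not necessarily unital. A ring $B$ is a ring with local units if for each finite subset $X\subseteq B$ there is an idempotent $e\in B$ with $ex=x=xe$ for all $x\in X$. Here $|G|B=\{|G|\,b: b\in B\}$. The group ring $B[G]$ is the set of formal sums $\sum_{g\in G}b_g g$ with $b_g\in B$, with componentwise addition and multiplication determined by $(bg)(b'g')=(bb')(gg')$. The extension $A/B$ is taken with respect to the inclusion $B\to A$, $b\mapsto b\,1_G$, where $1_G$ is the identity of $G$. For a ring homomorphism $f:B\to A$, $A$ is a $B$-bimodule via $b\cdot a=f(b)a$, $a\cdot b=af(b)$. $A/B$ is separable if there is an $A$-bimodule map $\sigma:A\to A\otimes_B A$ with $\mu\circ\sigma=\mathrm{id}_A$, where $\mu:A\otimes_B A\to A$, $\mu(a\otimes a')=aa'$, and $A\otimes_B A$ (the quotient of $A\otimes_{\mathbb Z}A$ by the subgroup generated by all $af(b)\otimes a'-a\otimes f(b)a'$) has the $A$-bimodule structure $x(a\otimes a')y=xa\otimes a'y$. *)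

theory Defs
  imports
    Complex_Main
    "HOL-Library.Poly_Mapping"
    "HOL-Library.Cardinality"
    "HOL-Computational_Algebra.Group_Closure"
begin

section \<open>Rings with local units\<close>

text \<open>
  The type class \<^class>\<open>ring\<close> describes associative rings that need not have a unit.
\<close>

definition local_units :: "'b::ring set \<Rightarrow> bool" where
  "local_units B \<longleftrightarrow>
    (\<forall>X. finite X \<and> X \<subseteq> B \<longrightarrow> (\<exists>e\<in>B. e * e = e \<and> (\<forall>x\<in>X. e * x = x \<and> x * e = x)))"

text \<open>
  Since there is no unit, \<open>of_int k * x\<close> is not available, and integer multiples are
  introduced as iterated sums.
\<close>

definition int_mult :: "int \<Rightarrow> 'a::ab_group_add \<Rightarrow> 'a" where
  "int_mult k x = (if 0 \<le> k then \<Sum>i<nat k. x else - (\<Sum>i<nat (- k). x))"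

lemma int_mult_0 [simp]: "int_mult 0 x = 0"
  by (simp add: int_mult_def)

lemma int_mult_1 [simp]: "int_mult 1 x = x"
  by (simp add: int_mult_def)

lemma int_mult_Suc: "int_mult (k + 1) x = int_mult k x + x"
proof (cases "0 \<le> k")
  case True
  then have "nat (k + 1) = Suc (nat k)" by simp
  with True show ?thesis by (simp add: int_mult_def)
next
  case False
  then have n: "nat (- k) = Suc (nat (- (k + 1)))" by simp
  show ?thesis
  proof (cases "k = - 1")
    case True
    then show ?thesis by (simp add: int_mult_def)
  next
    case neq: False
    with False have "\<not> 0 \<le> k + 1" by simp
    with False show ?thesis by (simp only: int_mult_def n) simp
  qed
qed

lemma int_mult_add: "int_mult (k + l) x = int_mult k x + int_mult l x"
proof (induction l rule: int_induct [where k = 0])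
  case base
  then show ?case by simp
next
  case (step1 i)
  then show ?case
    using int_mult_Suc [of "k + i" x] int_mult_Suc [of i x] by (simp add: add.assoc)
next
  case (step2 i)
  then show ?case
    using int_mult_Suc [of "k + (i - 1)" x] int_mult_Suc [of "i - 1" x]
    by (simp add: algebra_simps)
qed

lemma int_mult_minus: "int_mult (- k) x = - int_mult k x"
  using int_mult_add [of k "- k" x] by (simp add: eq_neg_iff_add_eq_0 add.commute)


section \<open>The tensor product over the integers\<close>

text \<open>
  The free abelian group on \<open>S\<close> is \<^typ>\<open>'s \<Rightarrow>\<^sub>0 int\<close> with generators \<^term>\<open>frag_of s\<close>;
  \<open>free_lift h\<close> is the additive map sending the generator of \<open>s\<close> to \<open>h s\<close>.
\<close>

definition free_lift :: "('s \<Rightarrow> 'a::ab_group_add) \<Rightarrow> ('s \<Rightarrow>\<^sub>0 int) \<Rightarrow> 'a" where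
  "free_lift h c = (\<Sum>s\<in>Poly_Mapping.keys c. int_mult (Poly_Mapping.lookup c s) (h s))"

lemma free_lift_frag_of [simp]: "free_lift h (frag_of s) = h s"
  by (simp add: free_lift_def)

lemma free_lift_superset:
  assumes "finite T" "Poly_Mapping.keys c \<subseteq> T"
  shows "free_lift h c = (\<Sum>s\<in>T. int_mult (Poly_Mapping.lookup c s) (h s))"
  unfolding free_lift_def
  using assms by (intro sum.mono_neutral_left) (auto simp: in_keys_iff)

lemma free_lift_add: "free_lift h (c + d) = free_lift h c + free_lift h d"
proof -
  let ?T = "Poly_Mapping.keys c \<union> Poly_Mapping.keys d"
  have "finite ?T" by simp
  moreover have "Poly_Mapping.keys (c + d) \<subseteq> ?T" by (rule Poly_Mapping.keys_add)
  ultimately show ?thesis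
    by (simp add: free_lift_superset [of ?T] lookup_add int_mult_add sum.distrib)
qed

lemma free_lift_zero [simp]: "free_lift h 0 = 0"
  by (simp add: free_lift_def)

lemma free_lift_minus: "free_lift h (- c) = - free_lift h c"
  using free_lift_add [of h c "- c"] by (simp add: eq_neg_iff_add_eq_0 add.commute)

lemma free_lift_diff: "free_lift h (c - d) = free_lift h c - free_lift h d"
  using free_lift_add [of h c "- d"] by (simp add: free_lift_minus)

definition bilinear_relations ::
    "('a::ab_group_add \<times> 'c::ab_group_add \<Rightarrow>\<^sub>0 int) set" where
  "bilinear_relations = group_closure
    ({frag_of (a + a', c) - frag_of (a, c) - frag_of (a', c) | a a' c. True} \<union>
     {frag_of (a, c + c') - frag_of (a, c) - frag_of (a, c') | a c c'. True})"

quotient_type (overloaded) ('a, 'c) tensor =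
    "('a::ab_group_add \<times> 'c::ab_group_add) \<Rightarrow>\<^sub>0 int" /
    "\<lambda>u v. u - v \<in> bilinear_relations"
proof (intro equivpI reflpI sympI transpI)
  fix u v w :: "('a \<times> 'c) \<Rightarrow>\<^sub>0 int"
  show "u - u \<in> bilinear_relations"
    by (simp add: bilinear_relations_def)
  show "v - u \<in> bilinear_relations" if "u - v \<in> bilinear_relations"
    using that group_closure_minus_iff [of "u - v"] by (simp add: bilinear_relations_def)
  show "u - w \<in> bilinear_relations" if "u - v \<in> bilinear_relations" "v - w \<in> bilinear_relations"
    using that group_closure_add [of "u - v" _ "v - w"] by (simp add: bilinear_relations_def)
qed

instantiation tensor :: (ab_group_add, ab_group_add) ab_group_add
begin

lift_definition zero_tensor :: "('a, 'b) tensor" is 0 .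

lift_definition plus_tensor :: "('a, 'b) tensor \<Rightarrow> ('a, 'b) tensor \<Rightarrow> ('a, 'b) tensor"
  is "(+)"
proof -
  fix u u' v v' :: "('a \<times> 'b) \<Rightarrow>\<^sub>0 int"
  assume "u - u' \<in> bilinear_relations" "v - v' \<in> bilinear_relations"
  then have "(u - u') + (v - v') \<in> bilinear_relations"
    unfolding bilinear_relations_def by (rule group_closure_add)
  then show "u + v - (u' + v') \<in> bilinear_relations"
    by (simp add: algebra_simps)
qed

lift_definition uminus_tensor :: "('a, 'b) tensor \<Rightarrow> ('a, 'b) tensor" is uminus
proof -
  fix u u' :: "('a \<times> 'b) \<Rightarrow>\<^sub>0 int"
  assume "u - u' \<in> bilinear_relations"
  then have "- (u - u') \<in> bilinear_relations"
    unfolding bilinear_relations_def by (simp only: group_closure_minus_iff)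
  then show "- u - - u' \<in> bilinear_relations"
    by (simp add: algebra_simps)
qed

definition minus_tensor :: "('a, 'b) tensor \<Rightarrow> ('a, 'b) tensor \<Rightarrow> ('a, 'b) tensor" where
  "minus_tensor s t = s + - t"

instance
proof
  fix r s t :: "('a, 'b) tensor"
  show "r + s + t = r + (s + t)"
    by transfer (simp add: bilinear_relations_def algebra_simps)
  show "r + s = s + r"
    by transfer (simp add: bilinear_relations_def algebra_simps)
  show "0 + r = r"
    by transfer (simp add: bilinear_relations_def)
  show "- r + r = 0"
    by transfer (simp add: bilinear_relations_def)
  show "r - s = r + - s"
    by (simp add: minus_tensor_def)
qed

end

lift_definition pure_tensor ::
    "'a::ab_group_add \<Rightarrow> 'c::ab_group_add \<Rightarrow> ('a, 'c) tensor" (infix "\<otimes>" 75)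
  is "\<lambda>a c. frag_of (a, c)" .

lemma bilinear_relation_left:
  "frag_of (a + a', c) - frag_of (a, c) - frag_of (a', c) \<in> bilinear_relations"
  unfolding bilinear_relations_def by (rule group_closure.base) blast

lemma bilinear_relation_right:
  "frag_of (a, c + c') - frag_of (a, c) - frag_of (a, c') \<in> bilinear_relations"
  unfolding bilinear_relations_def
  by (rule group_closure.base, rule insertI2, rule UnI2, rule CollectI)
    (rule exI [of _ a], rule exI [of _ c], rule exI [of _ c'], simp)

lemma pure_tensor_add_left: "(a + a') \<otimes> c = a \<otimes> c + a' \<otimes> c"
  by transfer (simp only: bilinear_relation_left diff_diff_eq [symmetric])

lemma pure_tensor_add_right: "a \<otimes> (c + c') = a \<otimes> c + a \<otimes> c'"
  by transfer (simp only: bilinear_relation_right diff_diff_eq [symmetric])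

lemma free_lift_respects:
  fixes h :: "'a::ab_group_add \<times> 'c::ab_group_add \<Rightarrow> 'd::ab_group_add"
  assumes left: "\<And>a a' c. h (a + a', c) = h (a, c) + h (a', c)"
    and right: "\<And>a c c'. h (a, c + c') = h (a, c) + h (a, c')"
    and "u - v \<in> bilinear_relations"
  shows "free_lift h u = free_lift h v"
proof -
  have "free_lift h w = 0" if "w \<in> bilinear_relations" for w
    using that unfolding bilinear_relations_def
    by (induction rule: group_closure.induct) (auto simp: free_lift_diff left right)
  from this [OF assms(3)] show ?thesis by (simp add: free_lift_diff)
qed

text \<open>
  The \<open>A\<close>-bimodule structure \<open>x (a \<otimes> a') y = xa \<otimes> a'y\<close> and the multiplication map
  \<open>a \<otimes> a' \<mapsto> aa'\<close>, first on the tensor product over the integers.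
\<close>

lift_definition left_act :: "'a::ring \<Rightarrow> ('a, 'c::ab_group_add) tensor \<Rightarrow> ('a, 'c) tensor"
  is "\<lambda>x. free_lift (\<lambda>(a, c). (x * a) \<otimes> c)"
  by (rule free_lift_respects)
    (simp_all add: pure_tensor_add_left pure_tensor_add_right distrib_left)

lift_definition right_act :: "('a::ab_group_add, 'c::ring) tensor \<Rightarrow> 'c \<Rightarrow> ('a, 'c) tensor"
  is "\<lambda>u y. free_lift (\<lambda>(a, c). a \<otimes> (c * y)) u"
  by (rule ext, rule free_lift_respects)
    (simp_all add: pure_tensor_add_left pure_tensor_add_right distrib_right)

lift_definition mult_map :: "('a::ring, 'a) tensor \<Rightarrow> 'a"
  is "free_lift (\<lambda>(a, a'). a * a')"
  by (rule free_lift_respects) (simp_all add: distrib_left distrib_right)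

lemma left_act_pure [simp]: "left_act x (a \<otimes> c) = (x * a) \<otimes> c"
  by transfer simp

lemma right_act_pure [simp]: "right_act (a \<otimes> c) y = a \<otimes> (c * y)"
  by transfer simp

lemma mult_map_pure [simp]: "mult_map (a \<otimes> a') = a * a'"
  by transfer simp

lemma left_act_add: "left_act x (s + t) = left_act x s + left_act x t"
  by transfer (simp add: free_lift_add)

lemma right_act_add: "right_act (s + t) y = right_act s y + right_act t y"
  by transfer (simp add: free_lift_add)

lemma mult_map_add: "mult_map (s + t) = mult_map s + mult_map t"
  by transfer (simp add: free_lift_add)


section \<open>The tensor product over a base ring\<close>

definition ring_hom :: "('b::ring \<Rightarrow> 'a::ring) \<Rightarrow> bool" where
  "ring_hom f \<longleftrightarrow> (\<forall>x y. f (x + y) = f x + f y) \<and> (\<forall>x y. f (x * y) = f x * f y)"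

definition balanced_subgroup :: "('b::ring \<Rightarrow> 'a::ring) \<Rightarrow> ('a, 'a) tensor set" where
  "balanced_subgroup f =
    group_closure {(a * f b) \<otimes> a' - a \<otimes> (f b * a') | a b a'. True}"

definition balanced_rel :: "('b::ring \<Rightarrow> 'a::ring) \<Rightarrow> (('a, 'a) tensor \<times> ('a, 'a) tensor) set"
  where "balanced_rel f = {(s, t). s - t \<in> balanced_subgroup f}"

text \<open>
  The group \<open>A \<otimes>\<^sub>B A\<close> depends on the homomorphism \<open>f\<close> and hence is not a type but a set of
  cosets. Its operations are those induced on representatives; the unions below are unions
  over all representatives of a coset, which yield the same coset each time (see the lemmas
  at the end of the section).
\<close>

definition tensor_over :: "('b::ring \<Rightarrow> 'a::ring) \<Rightarrow> ('a, 'a) tensor set set" where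
  "tensor_over f = UNIV // balanced_rel f"

definition over_add :: "('b::ring \<Rightarrow> 'a::ring) \<Rightarrow>
    ('a, 'a) tensor set \<Rightarrow> ('a, 'a) tensor set \<Rightarrow> ('a, 'a) tensor set" where
  "over_add f S T = (\<Union>s\<in>S. \<Union>t\<in>T. balanced_rel f `` {s + t})"

definition over_left :: "('b::ring \<Rightarrow> 'a::ring) \<Rightarrow>
    'a \<Rightarrow> ('a, 'a) tensor set \<Rightarrow> ('a, 'a) tensor set" where
  "over_left f x S = (\<Union>s\<in>S. balanced_rel f `` {left_act x s})"

definition over_right :: "('b::ring \<Rightarrow> 'a::ring) \<Rightarrow>
    ('a, 'a) tensor set \<Rightarrow> 'a \<Rightarrow> ('a, 'a) tensor set" where
  "over_right f S y = (\<Union>s\<in>S. balanced_rel f `` {right_act s y})"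

definition over_mult :: "('a::ring, 'a) tensor set \<Rightarrow> 'a" where
  "over_mult S = the_elem (mult_map ` S)"

lemma equiv_balanced_rel: "equiv UNIV (balanced_rel f)"
proof (rule equivI)
  show "refl (balanced_rel f)"
    by (simp add: refl_on_def balanced_rel_def balanced_subgroup_def)
  show "sym (balanced_rel f)"
  proof (rule symI)
    fix s t assume "(s, t) \<in> balanced_rel f"
    then show "(t, s) \<in> balanced_rel f"
      using group_closure_minus_iff [of "s - t"]
      by (simp add: balanced_rel_def balanced_subgroup_def)
  qed
  show "trans (balanced_rel f)"
  proof (rule transI)
    fix r s t assume "(r, s) \<in> balanced_rel f" "(s, t) \<in> balanced_rel f"
    then show "(r, t) \<in> balanced_rel f"
      using group_closure_add [of "r - s" _ "s - t"]
      by (simp add: balanced_rel_def balanced_subgroup_def)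
  qed
qed simp

lemma additive_group_closure:
  fixes h :: "'a::ab_group_add \<Rightarrow> 'c::ab_group_add"
  assumes add: "\<And>x y. h (x + y) = h x + h y"
    and "x \<in> group_closure S"
    and gen: "\<And>x. x \<in> S \<Longrightarrow> h x \<in> group_closure T"
  shows "h x \<in> group_closure T"
proof -
  interpret additive h by standard (rule add)
  from assms(2) show ?thesis
    by induction (auto simp: zero diff gen intro: group_closure.diff)
qed

lemma left_act_balanced:
  assumes "(s, t) \<in> balanced_rel f"
  shows "(left_act x s, left_act x t) \<in> balanced_rel f"
proof -
  interpret additive "left_act x :: ('a, 'a) tensor \<Rightarrow> _" by standard (rule left_act_add)
  have st: "s - t \<in> balanced_subgroup f"
    using assms by (simp add: balanced_rel_def)
  have "left_act x (s - t) \<in> balanced_subgroup f"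
    using st unfolding balanced_subgroup_def
  proof (rule additive_group_closure [of "left_act x", OF left_act_add])
    show "left_act x u \<in> group_closure {(a * f b) \<otimes> a' - a \<otimes> (f b * a') | a b a'. True}"
      if "u \<in> {(a * f b) \<otimes> a' - a \<otimes> (f b * a') | a b a'. True}" for u
    proof -
      from that obtain a b a' where "u = (a * f b) \<otimes> a' - a \<otimes> (f b * a')" by blast
      then have "left_act x u = ((x * a) * f b) \<otimes> a' - (x * a) \<otimes> (f b * a')"
        by (simp add: diff mult.assoc)
      then show ?thesis by (blast intro: group_closure.base)
    qed
  qed
  then show ?thesis by (simp add: balanced_rel_def diff)
qed

lemma right_act_balanced:
  assumes "(s, t) \<in> balanced_rel f"
  shows "(right_act s y, right_act t y) \<in> balanced_rel f"
proof -
  interpret additive "\<lambda>s :: ('a, 'a) tensor. right_act s y" by standard (rule right_act_add)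
  have st: "s - t \<in> balanced_subgroup f"
    using assms by (simp add: balanced_rel_def)
  have "right_act (s - t) y \<in> balanced_subgroup f"
    using st unfolding balanced_subgroup_def
  proof (rule additive_group_closure [of "\<lambda>s. right_act s y", OF right_act_add])
    show "right_act u y \<in> group_closure {(a * f b) \<otimes> a' - a \<otimes> (f b * a') | a b a'. True}"
      if "u \<in> {(a * f b) \<otimes> a' - a \<otimes> (f b * a') | a b a'. True}" for u
    proof -
      from that obtain a b a' where "u = (a * f b) \<otimes> a' - a \<otimes> (f b * a')" by blast
      then have "right_act u y = (a * f b) \<otimes> (a' * y) - a \<otimes> (f b * (a' * y))"
        by (simp add: diff mult.assoc)
      then show ?thesis by (blast intro: group_closure.base)
    qed
  qed
  then show ?thesis by (simp add: balanced_rel_def diff)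
qed

lemma mult_map_balanced:
  assumes "(s, t) \<in> balanced_rel f"
  shows "mult_map s = mult_map t"
proof -
  interpret additive "mult_map :: ('a, 'a) tensor \<Rightarrow> _" by standard (rule mult_map_add)
  have st: "s - t \<in> balanced_subgroup f"
    using assms by (simp add: balanced_rel_def)
  have "mult_map (s - t) \<in> group_closure {}"
    using st unfolding balanced_subgroup_def
    by (rule additive_group_closure [of mult_map, OF mult_map_add])
      (auto simp: diff mult.assoc)
  then show ?thesis by (simp add: diff)
qed

lemma over_add_class:
  "over_add f (balanced_rel f `` {s}) (balanced_rel f `` {t}) = balanced_rel f `` {s + t}"
  unfolding over_add_def
proof (rule UN_equiv_class2 [OF equiv_balanced_rel equiv_balanced_rel])
  show "congruent2 (balanced_rel f) (balanced_rel f) (\<lambda>s t. balanced_rel f `` {s + t})"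
  proof (rule congruent2I')
    fix s s' t t' assume "(s, s') \<in> balanced_rel f" "(t, t') \<in> balanced_rel f"
    then have "(s + t, s' + t') \<in> balanced_rel f"
      using group_closure_add [of "s - s'" _ "t - t'"]
      by (simp add: balanced_rel_def balanced_subgroup_def algebra_simps)
    then show "balanced_rel f `` {s + t} = balanced_rel f `` {s' + t'}"
      by (rule equiv_class_eq [OF equiv_balanced_rel])
  qed
qed simp_all

lemma over_left_class:
  "over_left f x (balanced_rel f `` {s}) = balanced_rel f `` {left_act x s}"
  unfolding over_left_def
  by (rule UN_equiv_class [OF equiv_balanced_rel])
    (auto intro!: congruentI equiv_class_eq [OF equiv_balanced_rel] left_act_balanced)

lemma over_right_class:
  "over_right f (balanced_rel f `` {s}) y = balanced_rel f `` {right_act s y}"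
  unfolding over_right_def
  by (rule UN_equiv_class [OF equiv_balanced_rel])
    (auto intro!: congruentI equiv_class_eq [OF equiv_balanced_rel] right_act_balanced)

lemma over_mult_class: "over_mult (balanced_rel f `` {s}) = mult_map s"
proof -
  have "s \<in> balanced_rel f `` {s}"
    by (rule equiv_class_self [OF equiv_balanced_rel]) simp
  then have "mult_map ` (balanced_rel f `` {s}) = {mult_map s}"
    by (auto dest: mult_map_balanced)
  then show ?thesis by (simp add: over_mult_def)
qed


section \<open>Separable extensions\<close>

definition bimodule_map ::
    "('b::ring \<Rightarrow> 'a::ring) \<Rightarrow> ('a \<Rightarrow> ('a, 'a) tensor set) \<Rightarrow> bool" where
  "bimodule_map f \<sigma> \<longleftrightarrow>
    (\<forall>a. \<sigma> a \<in> tensor_over f) \<and>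
    (\<forall>a a'. \<sigma> (a + a') = over_add f (\<sigma> a) (\<sigma> a')) \<and>
    (\<forall>x a. \<sigma> (x * a) = over_left f x (\<sigma> a)) \<and>
    (\<forall>a y. \<sigma> (a * y) = over_right f (\<sigma> a) y)"

definition separable :: "('b::ring \<Rightarrow> 'a::ring) \<Rightarrow> bool" where
  "separable f \<longleftrightarrow> ring_hom f \<and> (\<exists>\<sigma>. bimodule_map f \<sigma> \<and> (\<forall>a. over_mult (\<sigma> a) = a))"


section \<open>Group rings\<close>

text \<open>
  The library equips \<^typ>\<open>'g \<Rightarrow>\<^sub>0 'b\<close> with the convolution product, for which
  \<open>single g b * single h c = single (g + h) (b * c)\<close>. The group is therefore
  written additively; the class \<^class>\<open>group_add\<close> does not assume commutativity.
\<close>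

type_synonym ('b, 'g) group_ring = "'g \<Rightarrow>\<^sub>0 'b"

definition group_ring_incl :: "'b::ring \<Rightarrow> ('b, 'g::group_add) group_ring" where
  "group_ring_incl b = Poly_Mapping.single 0 b"

end

theory Submission
  imports Defs
begin

text \<open>
  Over a unital ring in which \<open>n = |G|\<close> is invertible, \<open>A = B[G]\<close> is separable because of the
  Casimir element \<open>n\<^sup>-\<^sup>1 \<Sum>\<^sub>g g\<^sup>-\<^sup>1 \<otimes> g\<close>, which commutes with \<open>A\<close> and is mapped to \<open>1\<close> by
  multiplication. Without a unit this element does not exist, but local versions of it do:
  for an idempotent \<open>e\<close> and an element \<open>u\<close> with \<open>n u = e\<close>, put
  \<open>D(u,e) = \<Sum>\<^sub>g u g\<^sup>-\<^sup>1 \<otimes> e g\<close>. The section is \<open>\<sigma>(a) = a D(u,e)\<close> for any \<open>e\<close> with \<open>a e = a\<close>.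

  Division by \<open>n\<close> is unique: an element \<open>x\<close> has a local unit, which by hypothesis has the
  form \<open>n u\<close>, so \<open>x = n u x = u (n x)\<close> is determined by \<open>n x\<close>
  (\<open>multiple_card_cancel\<close>). Uniqueness turns relations among idempotents into relations
  among their quotients by \<open>n\<close>. In particular, it shows that modulo \<open>B\<close>-balancing \<open>a D(u,e)\<close>
  does not change when \<open>e\<close> is enlarged (\<open>act_casimir_enlarge\<close>), and since any two
  idempotents have a common upper bound, \<open>\<sigma>\<close> is well defined
  (\<open>act_casimir_independent\<close>). To verify an identity for \<open>\<sigma>\<close>, one may thus use one
  idempotent that is a unit for all the coefficients in sight. Additivity and left linearity
  are then immediate, and right linearity is the relation \<open>y D(u,e) = D(u,e) y\<close>
  (\<open>casimir_commute\<close>).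
\<close>

section \<open>Division by the order of the group\<close>

text \<open>
  Writing \<open>|G| x\<close> as a sum over \<open>G\<close> makes its compatibility with products an instance of
  distributivity, and it is the form in which the multiple arises from \<open>\<Sum>\<^sub>g u g\<^sup>-\<^sup>1 g\<close>.
\<close>

abbreviation multiple_card :: "'g::finite itself \<Rightarrow> 'b::ring \<Rightarrow> 'b" where
  "multiple_card _ x \<equiv> (\<Sum>g\<in>(UNIV :: 'g set). x)"

lemma int_mult_card: "int_mult (int CARD('g::finite)) x = multiple_card TYPE('g) x"
proof -
  have "finite S \<Longrightarrow> (\<Sum>i<card S. x) = (\<Sum>s\<in>S. x)" for S :: "'g set"
    by (induction S rule: finite_induct) (simp_all add: add.commute)
  from this [of UNIV] show ?thesis by (simp add: int_mult_def)
qed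

text \<open>
  The additive group of a ring may well have \<open>|G|\<close>-torsion; it is the local units that
  exclude it, because they are themselves divisible by \<open>|G|\<close>.
\<close>

lemma multiple_card_cancel:
  fixes x y :: "'b::ring"
  assumes lu: "local_units (UNIV :: 'b set)"
    and surj: "surj (multiple_card TYPE('g::finite) :: 'b \<Rightarrow> 'b)"
    and eq: "multiple_card TYPE('g) x = multiple_card TYPE('g) y"
  shows "x = y"
proof -
  obtain e where e: "e * x = x" "e * y = y"
    using lu [unfolded local_units_def, rule_format, of "{x, y}"] by auto
  obtain u where u: "e = multiple_card TYPE('g) u"
    using surj by (meson surjD)
  have "e * z = u * multiple_card TYPE('g) z" for z
    by (simp only: u sum_distrib_right sum_distrib_left)
  with e eq show ?thesis by metis
qed

text \<open>The pairs \<open>(u, e)\<close> from which local Casimir elements are built.\<close>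

definition divided_idempotent :: "'g::finite itself \<Rightarrow> 'b::ring \<Rightarrow> 'b \<Rightarrow> bool" where
  "divided_idempotent G u e \<longleftrightarrow> e * e = e \<and> multiple_card G u = e"

lemma divided_idempotent_exists:
  fixes X :: "'b::ring set"
  assumes "local_units (UNIV :: 'b set)"
    and "surj (multiple_card TYPE('g::finite) :: 'b \<Rightarrow> 'b)"
    and "finite X"
  obtains u e where "divided_idempotent TYPE('g) u e" "\<forall>x\<in>X. e * x = x \<and> x * e = x"
proof -
  obtain e where "e * e = e" "\<forall>x\<in>X. e * x = x \<and> x * e = x"
    using assms(1) [unfolded local_units_def, rule_format, of X] assms(3) by auto
  moreover obtain u where "e = multiple_card TYPE('g) u"
    using assms(2) by (meson surjD)
  ultimately show ?thesis
    by (intro that [of u e]) (simp_all add: divided_idempotent_def)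
qed

section \<open>The balancing congruence\<close>

lemma balanced_rel_zero: "(0, 0) \<in> balanced_rel f"
  by (simp add: balanced_rel_def balanced_subgroup_def)

lemma balanced_rel_add:
  assumes "(s, t) \<in> balanced_rel f" "(s', t') \<in> balanced_rel f"
  shows "(s + s', t + t') \<in> balanced_rel f"
  using assms group_closure_add [of "s - t" _ "s' - t'"]
  by (simp add: balanced_rel_def balanced_subgroup_def algebra_simps)

lemma balanced_rel_sum:
  assumes "\<And>i. i \<in> I \<Longrightarrow> (s i, t i) \<in> balanced_rel f"
  shows "(sum s I, sum t I) \<in> balanced_rel f"
  using assms
  by (induction I rule: infinite_finite_induct)
    (simp_all add: balanced_rel_zero balanced_rel_add)

lemma balanced_rel_pure: "((a * f b) \<otimes> a', a \<otimes> (f b * a')) \<in> balanced_rel f"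
  unfolding balanced_rel_def balanced_subgroup_def
  by (auto intro: group_closure.base)

lemma balanced_rel_sym: "(s, t) \<in> balanced_rel f \<Longrightarrow> (t, s) \<in> balanced_rel f"
  using equiv_balanced_rel by (meson equivE symD)

lemma balanced_rel_trans:
  "(r, s) \<in> balanced_rel f \<Longrightarrow> (s, t) \<in> balanced_rel f \<Longrightarrow> (r, t) \<in> balanced_rel f"
  using equiv_balanced_rel by (meson equivE transD)

section \<open>Group rings\<close>

lemma ring_hom_group_ring_incl:
  "ring_hom (group_ring_incl :: 'b::ring \<Rightarrow> ('b, 'g::group_add) group_ring)"
  by (simp add: ring_hom_def group_ring_incl_def single_add mult_single)

lemma group_ring_sum_single:
  fixes y :: "('b::ring, 'g::{finite, group_add}) group_ring"
  shows "y = (\<Sum>h\<in>UNIV. Poly_Mapping.single h (Poly_Mapping.lookup y h))"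
  by (rule poly_mapping_eqI) (simp add: lookup_sum lookup_single when_def)

lemma group_ring_right_unit:
  fixes a :: "('b::ring, 'g::{finite, group_add}) group_ring"
  assumes "\<And>h. Poly_Mapping.lookup a h * e = Poly_Mapping.lookup a h"
  shows "a * group_ring_incl e = a"
proof -
  have "a * group_ring_incl e
      = (\<Sum>h\<in>UNIV. Poly_Mapping.single h (Poly_Mapping.lookup a h)) * group_ring_incl e"
    by (simp only: group_ring_sum_single [symmetric])
  also have "\<dots> = (\<Sum>h\<in>UNIV. Poly_Mapping.single h (Poly_Mapping.lookup a h))"
    by (simp add: sum_distrib_right group_ring_incl_def mult_single assms)
  finally show ?thesis by (simp only: group_ring_sum_single [symmetric])
qed

section \<open>Local Casimir elements\<close>

text \<open>
  The group is written additively, so \<open>-g\<close> is the inverse of \<open>g\<close>. The element is kept in the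
  tensor product over the integers; passing to classes modulo balancing is left to the end.
\<close>

definition casimir ::
    "'b::ring \<Rightarrow> 'b \<Rightarrow> (('b, 'g::{finite, group_add}) group_ring, ('b, 'g) group_ring) tensor" where
  "casimir u e = (\<Sum>g\<in>UNIV. Poly_Mapping.single (- g) u \<otimes> Poly_Mapping.single g e)"

lemma left_act_sum: "left_act x (sum t I) = (\<Sum>i\<in>I. left_act x (t i))"
proof -
  interpret additive "left_act x" by standard (rule left_act_add)
  show ?thesis by (rule sum)
qed

lemma right_act_sum: "right_act (sum t I) y = (\<Sum>i\<in>I. right_act (t i) y)"
proof -
  interpret additive "\<lambda>t. right_act t y" by standard (rule right_act_add)
  show ?thesis by (rule sum)
qed

lemma mult_map_sum: "mult_map (sum t I) = (\<Sum>i\<in>I. mult_map (t i))"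
proof -
  interpret additive mult_map by standard (rule mult_map_add)
  show ?thesis by (rule sum)
qed

lemma left_act_casimir:
  "left_act a (casimir u e) =
    (\<Sum>g\<in>UNIV. (a * Poly_Mapping.single (- g) u) \<otimes> Poly_Mapping.single g e)"
  by (simp add: casimir_def left_act_sum)

lemma right_act_casimir:
  "right_act (left_act a (casimir u e)) y =
    (\<Sum>g\<in>UNIV. (a * Poly_Mapping.single (- g) u) \<otimes> (Poly_Mapping.single g e * y))"
  by (simp add: left_act_casimir right_act_sum)

lemma act_casimir_add:
  "left_act (a + a') (casimir u e) = left_act a (casimir u e) + left_act a' (casimir u e)"
  by (simp add: left_act_casimir distrib_right pure_tensor_add_left sum.distrib)

lemma act_casimir_mult: "left_act (x * a) (casimir u e) = left_act x (left_act a (casimir u e))"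
  by (simp add: left_act_casimir left_act_sum mult.assoc)

lemma mult_map_act_casimir:
  fixes a :: "('b::ring, 'g::{finite, group_add}) group_ring"
  assumes ue: "divided_idempotent TYPE('g) u e" and a: "a * group_ring_incl e = a"
  shows "mult_map (left_act a (casimir u e)) = a"
proof -
  have single_sum: "Poly_Mapping.single (0::'g) (sum b (I :: 'g set))
      = (\<Sum>i\<in>I. Poly_Mapping.single 0 (b i))" for b :: "'g \<Rightarrow> 'b" and I
    by (induction I rule: infinite_finite_induct) (simp_all add: single_add)
  have "mult_map (left_act a (casimir u e))
      = a * Poly_Mapping.single 0 (\<Sum>g\<in>(UNIV :: 'g set). u * e)"
    by (simp only: left_act_casimir mult_map_sum mult_map_pure mult.assoc mult_single
        left_minus single_sum sum_distrib_left)
  also have "(\<Sum>g\<in>(UNIV :: 'g set). u * e) = e"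
    using ue by (simp only: divided_idempotent_def flip: sum_distrib_right)
  finally show ?thesis using a by (simp add: group_ring_incl_def)
qed

text \<open>
  A factor \<open>e\<close> can be moved to the right across the tensor sign, where it shrinks \<open>e'\<close> to \<open>e\<close>.
  One factor is provided by \<open>a = a e\<close>, and it makes \<open>u\<close> out of \<open>u'\<close> because \<open>|G|(e u') = e e' = e\<close>;
  since \<open>u = u e\<close>, another one can be split off from \<open>u\<close>.
\<close>

lemma act_casimir_enlarge:
  fixes a :: "('b::ring, 'g::{finite, group_add}) group_ring"
  assumes lu: "local_units (UNIV :: 'b set)"
    and surj: "surj (multiple_card TYPE('g) :: 'b \<Rightarrow> 'b)"
    and ue: "divided_idempotent TYPE('g) u e"
    and ue': "divided_idempotent TYPE('g) u' e'"
    and a: "a * group_ring_incl e = a" and le: "e * e' = e"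
  shows "(left_act a (casimir u' e'), left_act a (casimir u e)) \<in> balanced_rel group_ring_incl"
  unfolding left_act_casimir
proof (rule balanced_rel_sum)
  fix g :: 'g
  let ?s = "Poly_Mapping.single :: 'g \<Rightarrow> 'b \<Rightarrow> _"
  have "multiple_card TYPE('g) (e * u') = multiple_card TYPE('g) u"
    using ue ue' le by (simp only: divided_idempotent_def flip: sum_distrib_left)
  then have eu': "e * u' = u"
    by (rule multiple_card_cancel [OF lu surj])
  have "multiple_card TYPE('g) (u * e) = multiple_card TYPE('g) u"
    using ue by (simp only: divided_idempotent_def flip: sum_distrib_right)
  then have ue_u: "u * e = u"
    by (rule multiple_card_cancel [OF lu surj])
  have "a * ?s (- g) u' = (a * group_ring_incl e) * ?s (- g) u'"
    by (simp only: a)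
  also have "\<dots> = a * ?s (- g) u"
    by (simp add: group_ring_incl_def mult.assoc mult_single eu')
  finally have u': "a * ?s (- g) u' = a * ?s (- g) u" .
  have u: "(a * ?s (- g) u) * group_ring_incl e = a * ?s (- g) u"
    by (simp add: group_ring_incl_def mult.assoc mult_single ue_u)
  have e: "group_ring_incl e * ?s g e' = ?s g e"
    by (simp add: group_ring_incl_def mult_single le)
  show "((a * ?s (- g) u') \<otimes> ?s g e', (a * ?s (- g) u) \<otimes> ?s g e) \<in> balanced_rel group_ring_incl"
    using balanced_rel_pure [of "a * ?s (- g) u" group_ring_incl e "?s g e'"]
    by (simp only: u u' e)
qed

lemma act_casimir_independent:
  fixes a :: "('b::ring, 'g::{finite, group_add}) group_ring"
  assumes lu: "local_units (UNIV :: 'b set)"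
    and surj: "surj (multiple_card TYPE('g) :: 'b \<Rightarrow> 'b)"
    and ue: "divided_idempotent TYPE('g) u e" "a * group_ring_incl e = a"
    and ue': "divided_idempotent TYPE('g) u' e'" "a * group_ring_incl e' = a"
  shows "(left_act a (casimir u e), left_act a (casimir u' e')) \<in> balanced_rel group_ring_incl"
proof -
  obtain v d where vd: "divided_idempotent TYPE('g) v d"
    and d: "\<forall>x\<in>{e, e'}. d * x = x \<and> x * d = x"
    using divided_idempotent_exists [OF lu surj, of "{e, e'}"] by blast
  have "(left_act a (casimir v d), left_act a (casimir u e)) \<in> balanced_rel group_ring_incl"
    using d by (intro act_casimir_enlarge [OF lu surj ue(1) vd ue(2)]) simp
  moreover
  have "(left_act a (casimir v d), left_act a (casimir u' e')) \<in> balanced_rel group_ring_incl"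
    using d by (intro act_casimir_enlarge [OF lu surj ue'(1) vd ue'(2)]) simp
  ultimately show ?thesis
    by (rule balanced_rel_trans [OF balanced_rel_sym])
qed

text \<open>
  By additivity \<open>y\<close> may be taken to be \<open>b h\<close>. The substitution \<open>g \<mapsto> g h\<close> moves \<open>h\<close> from one side
  of the Casimir element to the other, as in the classical proof of Maschke's theorem. The
  coefficient \<open>b\<close> crosses the tensor sign by balancing, and it commutes with \<open>u\<close> since both
  \<open>|G|(u b)\<close> and \<open>|G|(b u)\<close> are equal to \<open>b\<close>.
\<close>

lemma casimir_commute:
  fixes a y :: "('b::ring, 'g::{finite, group_add}) group_ring"
  assumes lu: "local_units (UNIV :: 'b set)"
    and surj: "surj (multiple_card TYPE('g) :: 'b \<Rightarrow> 'b)"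
    and ue: "divided_idempotent TYPE('g) u e"
    and y: "\<And>h. e * Poly_Mapping.lookup y h = Poly_Mapping.lookup y h"
      "\<And>h. Poly_Mapping.lookup y h * e = Poly_Mapping.lookup y h"
  shows "(left_act (a * y) (casimir u e), right_act (left_act a (casimir u e)) y)
    \<in> balanced_rel group_ring_incl"
proof -
  let ?s = "Poly_Mapping.single :: 'g \<Rightarrow> 'b \<Rightarrow> _"
  let ?L = "\<lambda>y. left_act (a * y) (casimir u e)"
  let ?R = "\<lambda>y. right_act (left_act a (casimir u e)) y"
  have monomial: "(?L (?s h b), ?R (?s h b)) \<in> balanced_rel group_ring_incl"
    if b: "e * b = b" "b * e = b" for h b
  proof -
    have "multiple_card TYPE('g) (u * b) = b"
      using ue b by (simp only: divided_idempotent_def flip: sum_distrib_right)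
    also have "b = multiple_card TYPE('g) (b * u)"
      using ue b by (simp only: divided_idempotent_def flip: sum_distrib_left)
    finally have ub: "u * b = b * u"
      by (rule multiple_card_cancel [OF lu surj])
    have "?R (?s h b) = (\<Sum>g\<in>UNIV. (a * ?s (- g) u) \<otimes> ?s (g + h) b)"
      by (simp add: right_act_casimir mult_single b)
    also have "\<dots> = (\<Sum>g\<in>UNIV. (a * ?s (h - g) u) \<otimes> ?s g b)"
      by (rule sum.reindex_bij_witness [of _ "\<lambda>g. g - h" "\<lambda>g. g + h"])
        (simp_all add: diff_add_eq_diff_diff_swap)
    finally have R: "?R (?s h b) = (\<Sum>g\<in>UNIV. (a * ?s (h - g) u) \<otimes> ?s g b)" .
    have L: "?L (?s h b) = (\<Sum>g\<in>UNIV. (a * ?s (h - g) (b * u)) \<otimes> ?s g e)"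
      by (simp add: left_act_casimir mult.assoc mult_single)
    have "((a * ?s (h - g) (b * u)) \<otimes> ?s g e, (a * ?s (h - g) u) \<otimes> ?s g b)
        \<in> balanced_rel group_ring_incl" for g
      using balanced_rel_pure [of "a * ?s (h - g) u" group_ring_incl b "?s g e"]
      by (simp add: group_ring_incl_def mult.assoc mult_single ub b)
    then show ?thesis unfolding L R by (intro balanced_rel_sum)
  qed
  interpret L: additive ?L
    by standard (simp add: distrib_left act_casimir_add)
  interpret R: additive ?R
    by standard (simp add: right_act_casimir distrib_left pure_tensor_add_right sum.distrib)
  let ?y = "\<Sum>h\<in>UNIV. ?s h (Poly_Mapping.lookup y h)"
  have "(?L ?y, ?R ?y) \<in> balanced_rel group_ring_incl"
    unfolding L.sum R.sum by (intro balanced_rel_sum monomial y)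
  then show ?thesis by (simp only: group_ring_sum_single [symmetric])
qed

section \<open>Separability\<close>

theorem theorem5:
  assumes "local_units (UNIV :: 'b::ring set)"
    and "int_mult (int CARD('g::{finite, group_add})) ` (UNIV :: 'b set) = UNIV"
  shows "separable (group_ring_incl :: 'b \<Rightarrow> ('b, 'g) group_ring)"
proof -
  let ?f = "group_ring_incl :: 'b \<Rightarrow> ('b, 'g) group_ring"
  let ?cl = "\<lambda>t. balanced_rel ?f `` {t}"
  let ?unit = "\<lambda>a (u, e). divided_idempotent TYPE('g) u e \<and> a * ?f e = a"
  let ?D = "\<lambda>(u, e). casimir u e"
  define \<sigma> where "\<sigma> a = ?cl (left_act a (?D (SOME p. ?unit a p)))" for a
  note lu = assms(1)
  have surj: "surj (multiple_card TYPE('g) :: 'b \<Rightarrow> 'b)"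
    using assms(2) by (simp only: int_mult_card [abs_def])

  \<comment> \<open>The choice made in \<open>\<sigma>\<close> is immaterial, so each axiom may be checked with its own unit.\<close>
  have \<sigma>: "\<sigma> a = ?cl (left_act a (casimir u e))"
    if "divided_idempotent TYPE('g) u e" "a * ?f e = a" for a u e
  proof -
    obtain u' e' where p: "(SOME p. ?unit a p) = (u', e')" by fastforce
    have "?unit a (u', e')"
      using someI [of "?unit a" "(u, e)"] that unfolding p by simp
    then have "(left_act a (casimir u' e'), left_act a (casimir u e)) \<in> balanced_rel ?f"
      using that by (intro act_casimir_independent [OF lu surj]) simp_all
    then show ?thesis
      unfolding \<sigma>_def p by (simp add: equiv_class_eq [OF equiv_balanced_rel])
  qed

  \<comment> \<open>Only right linearity needs a two-sided unit, and only for the coefficients of \<open>a'\<close>.\<close>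
  have common_unit: "\<exists>u e. divided_idempotent TYPE('g) u e \<and> a * ?f e = a \<and> a' * ?f e = a' \<and>
      (\<forall>h. e * Poly_Mapping.lookup a' h = Poly_Mapping.lookup a' h \<and>
        Poly_Mapping.lookup a' h * e = Poly_Mapping.lookup a' h)" for a a' :: "('b, 'g) group_ring"
  proof -
    obtain u e where ue: "divided_idempotent TYPE('g) u e"
      and e: "\<forall>x\<in>range (Poly_Mapping.lookup a) \<union> range (Poly_Mapping.lookup a').
        e * x = x \<and> x * e = x"
      using divided_idempotent_exists [OF lu surj,
          of "range (Poly_Mapping.lookup a) \<union> range (Poly_Mapping.lookup a')"]
      by auto
    then show ?thesis by (intro exI [of _ u] exI [of _ e]) (simp add: group_ring_right_unit)
  qed

  have "bimodule_map ?f \<sigma>"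
    unfolding bimodule_map_def
  proof (intro conjI allI)
    fix a a' x y :: "('b, 'g) group_ring"
    show "\<sigma> a \<in> tensor_over ?f"
      by (simp add: \<sigma>_def tensor_over_def quotientI)
    obtain u e where "divided_idempotent TYPE('g) u e" "a * ?f e = a" "a' * ?f e = a'"
      using common_unit by blast
    then show "\<sigma> (a + a') = over_add ?f (\<sigma> a) (\<sigma> a')"
      by (simp add: \<sigma> [of u e] distrib_right over_add_class act_casimir_add)
    obtain u e where "divided_idempotent TYPE('g) u e" "a * ?f e = a"
      using common_unit by blast
    then show "\<sigma> (x * a) = over_left ?f x (\<sigma> a)"
      by (simp add: \<sigma> [of u e] mult.assoc over_left_class act_casimir_mult)
    obtain u e where ue: "divided_idempotent TYPE('g) u e" "a * ?f e = a" "y * ?f e = y"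
      and y: "\<And>h. e * Poly_Mapping.lookup y h = Poly_Mapping.lookup y h"
        "\<And>h. Poly_Mapping.lookup y h * e = Poly_Mapping.lookup y h"
      using common_unit [of a y] by blast
    from ue show "\<sigma> (a * y) = over_right ?f (\<sigma> a) y"
      by (simp add: \<sigma> [of u e] mult.assoc over_right_class
          equiv_class_eq [OF equiv_balanced_rel casimir_commute [OF lu surj ue(1) y]])
  qed
  moreover have "over_mult (\<sigma> a) = a" for a
  proof -
    obtain u e where "divided_idempotent TYPE('g) u e" "a * ?f e = a"
      using common_unit by blast
    then show ?thesis
      by (simp add: \<sigma> [of u e] over_mult_class mult_map_act_casimir)
  qed
  ultimately show ?thesis
    unfolding separable_def using ring_hom_group_ring_incl by blast
qed

end
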